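(* Let $\mathcal{Z}$ be a zero-set with $\mathcal{Z}\subseteq R_{a,b}$ for some integers $a,b\ge 1$. If $2\le L\le\infty$ and $m,n\in\mathbb{N}$ satisfy $m,n>ab$, then $\gamma^L(\mathcal{Z},m,n)=\gamma^L(\mathcal{Z},\infty,\infty)$. If, in addition, $L\ge 2ab+5$, then $$\gamma^L(\mathcal{Z},m,n)=\gamma^\infty(\mathcal{Z},\infty,\infty)\in[\,|\mathcal{Z}|/4,\ |\mathcal{Z}|\,].$$ Moreover, for each $L\in\{0,1,2\}$, $$\sup_{\mathcal{Z},m,n}\frac{\gamma^{L}(\mathcal{Z},m,n)}{\gamma^{L+1}(\mathcal{Z},m,n)}=\infty,$$ where the supremum is over all finite zero-sets $\mathcal{Z}$ and all $m,n\in\mathbb{N}$ with $\gamma^{L+1}(\mathcal{Z},m,n)>0$.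
   Context: $\mathbb{Z}_+=\{0,1,2,\dots\}$, $\mathbb{N}=\{1,2,\dots\}$, $[0,c]=\{0,1,\dots,c\}$, and, for integers $a,b\ge1$, $R_{a,b}=[0,a-1]\times[0,b-1]$; also $R_{\infty,\infty}=\mathbb{Z}_+^2$. A zero-set (Young diagram) is a downward-closed set $\mathcal{Z}\subseteq\mathbb{Z}_+^2$. For $m,n\in\mathbb{N}$ (or $m=n=\infty$), the graph $K_m\Box K_n$ is represented on the vertex set $R_{n,m}$, with two vertices adjacent iff they differ in exactly one coordinate. For $v=(j,i)\in R_{n,m}$, the row neighborhood $\mathcal{N}^r(v)$ is the set of all $(j',i)\in R_{n,m}$ with $j'\neq j$, and the column neighborhood $\mathcal{N}^c(v)$ is the set of all $(j,i')\in R_{n,m}$ with $i'\ne i$. Given $\mathcal{Z}$, for $A\subseteq R_{n,m}$ let $\mathcal{T}(A)=A\cup\{v\in R_{n,m}\setminus A\colon (|\mathcal{N}^r(v)\cap A|,|\mathcal{N}^c(v)\cap A|)\notin\mathcal{Z}\}$; $\mathcal{T}^L$ is the $L$-fold iterate, with $\mathcal{T}^0(A)=A$, and $\mathcal{T}^\infty(A)=\bigcup_{t\ge0}\mathcal{T}^t(A)$. For $L\in\mathbb{Z}_+\cup\{\infty\}$, $\gamma^L(\mathcal{Z},m,n)=\min\{|A|\colon A\subseteq R_{n,m},\ \mathcal{T}^L(A)=R_{n,m}\}$. *)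

theory Defs
  imports "HOL-Library.Extended_Real"
begin

definition rect :: "enat \<Rightarrow> enat \<Rightarrow> (nat \<times> nat) set" where
  "rect a b = {(j, i). enat j < a \<and> enat i < b}"

definition zero_set :: "(nat \<times> nat) set \<Rightarrow> bool" where
  "zero_set Z \<longleftrightarrow> (\<forall>(u, v) \<in> Z. \<forall>u' \<le> u. \<forall>v' \<le> v. (u', v') \<in> Z)"

(* In the infinite graph a neighborhood may contain infinitely many occupied vertices,
   and sets A may be infinite, whereas card would assign 0 to such sets. *)
definition ecard :: "'a set \<Rightarrow> enat" where
  "ecard A = (if finite A then enat (card A) else \<infinity>)"

(* The graph K_m x K_n (Cartesian product) lives on rect n m: the first coordinate of a
   vertex ranges below n, the second one below m. *)
definition row_nbhd :: "enat \<Rightarrow> enat \<Rightarrow> nat \<times> nat \<Rightarrow> (nat \<times> nat) set" where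
  "row_nbhd m n = (\<lambda>(j, i). {(j', i) | j'. (j', i) \<in> rect n m \<and> j' \<noteq> j})"

definition col_nbhd :: "enat \<Rightarrow> enat \<Rightarrow> nat \<times> nat \<Rightarrow> (nat \<times> nat) set" where
  "col_nbhd m n = (\<lambda>(j, i). {(j, i') | i'. (j, i') \<in> rect n m \<and> i' \<noteq> i})"

(* Z is embedded into pairs of extended naturals, so a pair of counts with an infinite
   component is never in Z. *)
definition growth_step ::
    "(nat \<times> nat) set \<Rightarrow> enat \<Rightarrow> enat \<Rightarrow> (nat \<times> nat) set \<Rightarrow> (nat \<times> nat) set" where
  "growth_step Z m n A =
     A \<union> {v \<in> rect n m - A.
            (ecard (row_nbhd m n v \<inter> A), ecard (col_nbhd m n v \<inter> A)) \<notin> map_prod enat enat ` Z}"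

definition growth ::
    "(nat \<times> nat) set \<Rightarrow> enat \<Rightarrow> enat \<Rightarrow> enat \<Rightarrow> (nat \<times> nat) set \<Rightarrow> (nat \<times> nat) set" where
  "growth Z m n L A =
     (case L of enat k \<Rightarrow> (growth_step Z m n ^^ k) A
              | \<infinity> \<Rightarrow> (\<Union>t. (growth_step Z m n ^^ t) A))"

(* The infimum is a minimum: A = rect n m is always admissible and enat is well-ordered. *)
definition gamma :: "enat \<Rightarrow> (nat \<times> nat) set \<Rightarrow> enat \<Rightarrow> enat \<Rightarrow> enat" where
  "gamma L Z m n = Inf {ecard A | A. A \<subseteq> rect n m \<and> growth Z m n L A = rect n m}"

end

theory Submission
  imports Defs
begin

text \<open>If A leaves a row and a column of the board empty, then the growth in the plane is the
  pullback of the growth on the board under the retraction that sends all lines outside the board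
  to the empty ones; as an a-by-b block spans in two steps, only sets with at most ab elements
  matter, and these leave empty lines.

  For the spanning time, count for each r the rows with at least r occupied vertices, capped at b,
  and the full rows, also capped, and do the same for columns. The total is at most 2ab, and every
  step increases it unless the growth stops or some count has reached its cap in both directions,
  in which case a full b-by-a grid appears and everything is filled in three steps.

  For the lower bound on the extremal size, if d(s) columns contain more than s vertices of A and
  e(p) rows more than p, then (p + d(s), s + e(p)) is outside Z; both d and e sum to |A|.

  The last ratio comes from a cross with arms of length k^2 around a k-by-k square: two steps
  need k lines with k^2 vertices each, whereas in three steps one such row and column reduce the
  requirement for further lines to k.\<close>

section \<open>Extended cardinalities and the complement of a zero-set\<close>

lemma ecard_mono: "X \<subseteq> Y \<Longrightarrow> ecard X \<le> ecard Y"
  by (auto simp: ecard_def card_mono dest: finite_subset)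

lemma ecard_image: "inj_on f X \<Longrightarrow> ecard (f ` X) = ecard X"
  by (simp add: ecard_def card_image finite_image_iff)

lemma ecard_empty [simp]: "ecard {} = 0"
  by (simp add: ecard_def zero_enat_def)

text \<open>Lower bounds on possibly infinite counts are proved and used through finite
  witnesses.\<close>

lemma enat_le_ecard_iff: "enat k \<le> ecard X \<longleftrightarrow> (\<exists>Y\<subseteq>X. finite Y \<and> card Y = k)"
proof
  assume *: "enat k \<le> ecard X"
  show "\<exists>Y\<subseteq>X. finite Y \<and> card Y = k"
  proof (cases "finite X")
    case True
    with * show ?thesis
      by (metis ecard_def enat_ord_simps(1) finite_subset obtain_subset_with_card_n)
  next
    case False
    then show ?thesis using infinite_arbitrarily_large by blast
  qed
next
  assume "\<exists>Y\<subseteq>X. finite Y \<and> card Y = k"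
  then show "enat k \<le> ecard X" using ecard_mono by (metis ecard_def)
qed

text \<open>The condition under which a vertex becomes occupied. An infinite count always satisfies
  it, since the embedded zero-set has finite pairs only.\<close>

definition outside :: "(nat \<times> nat) set \<Rightarrow> enat \<Rightarrow> enat \<Rightarrow> bool" where
  "outside Z x y \<longleftrightarrow> (x, y) \<notin> map_prod enat enat ` Z"

lemma outside_enat [simp]: "outside Z (enat x) (enat y) \<longleftrightarrow> (x, y) \<notin> Z"
  by (auto simp: outside_def)

lemma zero_setD: "zero_set Z \<Longrightarrow> (u, v) \<in> Z \<Longrightarrow> u' \<le> u \<Longrightarrow> v' \<le> v \<Longrightarrow> (u', v') \<in> Z"
  unfolding zero_set_def by blast

lemma outside_mono:
  assumes "zero_set Z" "outside Z x y" "x \<le> x'" "y \<le> y'"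
  shows "outside Z x' y'"
proof (rule ccontr)
  assume "\<not> outside Z x' y'"
  then obtain u' v' where *: "(u', v') \<in> Z" "x' = enat u'" "y' = enat v'"
    by (auto simp: outside_def)
  then obtain u v where "x = enat u" "y = enat v" "u \<le> u'" "v \<le> v'"
    using assms(3,4) by (cases x; cases y) auto
  with * assms(1,2) show False by (auto simp: zero_set_def)
qed

lemma outside_row:
  assumes "Z \<subseteq> rect (enat a) b" "enat a \<le> x" shows "outside Z x y"
  using assms by (force simp: outside_def rect_def)

lemma outside_col:
  assumes "Z \<subseteq> rect a (enat b)" "enat b \<le> y" shows "outside Z x y"
  using assms by (force simp: outside_def rect_def)

section \<open>Growth in terms of the counts in whole rows and columns\<close>

abbreviation row :: "(nat \<times> nat) set \<Rightarrow> nat \<Rightarrow> nat set" where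
  "row S i \<equiv> {k. (k, i) \<in> S}"

abbreviation col :: "(nat \<times> nat) set \<Rightarrow> nat \<Rightarrow> nat set" where
  "col S j \<equiv> {k. (j, k) \<in> S}"

text \<open>An unoccupied vertex does not contribute to its own lines, and S lies on the board, so
  the neighborhood counts equal the counts in the entire row and column of S.\<close>

lemma mem_growth_step:
  assumes "S \<subseteq> rect n m"
  shows "(j, i) \<in> growth_step Z m n S \<longleftrightarrow>
    (j, i) \<in> S \<or> (j, i) \<in> rect n m \<and> outside Z (ecard (row S i)) (ecard (col S j))"
proof (cases "(j, i) \<in> S")
  case False
  have "row_nbhd m n (j, i) \<inter> S = (\<lambda>k. (k, i)) ` row S i"
    using False assms by (auto simp: row_nbhd_def)
  moreover have "col_nbhd m n (j, i) \<inter> S = Pair j ` col S j"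
    using False assms by (auto simp: col_nbhd_def)
  ultimately show ?thesis
    using False by (simp add: growth_step_def outside_def ecard_image inj_on_def)
qed (simp add: growth_step_def)

lemma growth_step_increasing: "v \<in> S \<Longrightarrow> v \<in> growth_step Z m n S"
  by (auto simp: growth_step_def)

lemma growth_step_subset_rect: "S \<subseteq> rect n m \<Longrightarrow> growth_step Z m n S \<subseteq> rect n m"
  by (auto simp: growth_step_def)

lemma rect_infinity [simp]: "rect \<infinity> \<infinity> = UNIV"
  by (auto simp: rect_def)

lemma iterate_subset_rect: "A \<subseteq> rect n m \<Longrightarrow> (growth_step Z m n ^^ t) A \<subseteq> rect n m"
  by (induction t) (auto simp: growth_step_subset_rect)

lemma iterate_mono_time: "s \<le> t \<Longrightarrow> (growth_step Z m n ^^ s) A \<subseteq> (growth_step Z m n ^^ t) A"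
  by (rule lift_Suc_mono_le[of "\<lambda>t. (growth_step Z m n ^^ t) A"]) (auto simp: growth_step_def)

text \<open>The iterates increase, so the one at a finite time is the union of all up to it. This
  treats finite and infinite L uniformly.\<close>

lemma growth_eq_Union:
  "growth Z m n L A = (\<Union>t\<in>{t. enat t \<le> L}. (growth_step Z m n ^^ t) A)"
proof (cases L)
  case (enat l)
  then show ?thesis
    using iterate_mono_time[of _ l Z m n A] by (auto simp: growth_def)
qed (simp add: growth_def)

section \<open>Spanning sets and their minimal size\<close>

definition spans :: "enat \<Rightarrow> (nat \<times> nat) set \<Rightarrow> enat \<Rightarrow> enat \<Rightarrow> (nat \<times> nat) set \<Rightarrow> bool" where
  "spans L Z m n A \<longleftrightarrow> A \<subseteq> rect n m \<and> growth Z m n L A = rect n m"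

lemma spans_iterateI:
  assumes "A \<subseteq> rect n m" "rect n m \<subseteq> (growth_step Z m n ^^ t) A" "enat t \<le> L"
  shows "spans L Z m n A"
  unfolding spans_def growth_eq_Union
  using assms iterate_subset_rect[OF assms(1), where Z = Z] by blast

lemma spans_mono: "spans L Z m n A \<Longrightarrow> L \<le> L' \<Longrightarrow> spans L' Z m n A"
  unfolding spans_def growth_eq_Union
  using iterate_subset_rect[of A n m, where Z = Z] order_trans by blast

lemma spans_rect: "spans L Z m n (rect n m)"
  by (rule spans_iterateI[where t = 0]) (auto simp: zero_enat_def[symmetric])

lemma gamma_le: "spans L Z m n A \<Longrightarrow> gamma L Z m n \<le> ecard A"
  unfolding gamma_def spans_def by (intro Inf_lower) auto

lemma gamma_attained: obtains A where "spans L Z m n A" "gamma L Z m n = ecard A"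
proof -
  let ?E = "{ecard A |A. A \<subseteq> rect n m \<and> growth Z m n L A = rect n m}"
  have "ecard (rect n m) \<in> ?E"
    using spans_rect[of L Z m n] by (auto simp: spans_def)
  then have "Inf ?E \<in> ?E" unfolding Inf_enat_def by (metis (no_types, lifting) LeastI empty_iff)
  then show thesis using that by (auto simp: gamma_def spans_def)
qed

lemma gamma_antimono: "L \<le> L' \<Longrightarrow> gamma L' Z m n \<le> gamma L Z m n"
  using gamma_attained gamma_le spans_mono by metis

lemma le_gammaI: "(\<And>A. spans L Z m n A \<Longrightarrow> e \<le> ecard A) \<Longrightarrow> e \<le> gamma L Z m n"
  by (metis gamma_attained)

lemma mem_growth_step_plane:
  "(j, i) \<in> growth_step Z \<infinity> \<infinity> S \<longleftrightarrow> (j, i) \<in> S \<or> outside Z (ecard (row S i)) (ecard (col S j))"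
  by (simp add: mem_growth_step)

subsection \<open>Finite boards versus the plane\<close>

text \<open>The column \<open>j0\<close> starts empty, hence contained in the column j. The
  containment persists: two vertices of one row share the row count, and the one in column j has the
  larger column count.\<close>

lemma iterate_col_dominates:
  assumes "zero_set Z" "A \<subseteq> rect n m" "col A j0 = {}" "enat j < n"
    and "(j0, i) \<in> (growth_step Z m n ^^ t) A"
  shows "(j, i) \<in> (growth_step Z m n ^^ t) A"
  using assms(5)
proof (induction t arbitrary: i)
  case (Suc t)
  let ?S = "(growth_step Z m n ^^ t) A"
  have S: "?S \<subseteq> rect n m" using assms(2) by (rule iterate_subset_rect)
  have le: "ecard (col ?S j0) \<le> ecard (col ?S j)" using Suc.IH by (auto intro!: ecard_mono)
  from Suc.prems have "(j0, i) \<in> ?S \<or>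
      (j0, i) \<in> rect n m \<and> outside Z (ecard (row ?S i)) (ecard (col ?S j0))"
    by (simp add: mem_growth_step[OF S])
  then show ?case
  proof
    assume "(j0, i) \<in> ?S"
    then show ?thesis using Suc.IH by (simp add: growth_step_increasing)
  next
    assume "(j0, i) \<in> rect n m \<and> outside Z (ecard (row ?S i)) (ecard (col ?S j0))"
    moreover from this have "outside Z (ecard (row ?S i)) (ecard (col ?S j))"
      using le by (auto intro: outside_mono[OF assms(1)])
    ultimately show ?thesis using assms(4) by (simp add: mem_growth_step[OF S] rect_def)
  qed
qed (use assms(3) in auto)

text \<open>The same domination argument with rows and columns exchanged.\<close>

lemma iterate_row_dominates:
  assumes "zero_set Z" "A \<subseteq> rect n m" "row A i0 = {}" "enat i < m"
    and "(j, i0) \<in> (growth_step Z m n ^^ t) A"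
  shows "(j, i) \<in> (growth_step Z m n ^^ t) A"
  using assms(5)
proof (induction t arbitrary: j)
  case (Suc t)
  let ?S = "(growth_step Z m n ^^ t) A"
  have S: "?S \<subseteq> rect n m" using assms(2) by (rule iterate_subset_rect)
  have le: "ecard (row ?S i0) \<le> ecard (row ?S i)" using Suc.IH by (auto intro!: ecard_mono)
  from Suc.prems have "(j, i0) \<in> ?S \<or>
      (j, i0) \<in> rect n m \<and> outside Z (ecard (row ?S i0)) (ecard (col ?S j))"
    by (simp add: mem_growth_step[OF S])
  then show ?case
  proof
    assume "(j, i0) \<in> ?S"
    then show ?thesis using Suc.IH by (simp add: growth_step_increasing)
  next
    assume "(j, i0) \<in> rect n m \<and> outside Z (ecard (row ?S i0)) (ecard (col ?S j))"
    moreover from this have "outside Z (ecard (row ?S i)) (ecard (col ?S j))"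
      using le by (auto intro: outside_mono[OF assms(1)])
    ultimately show ?thesis using assms(4) by (simp add: mem_growth_step[OF S] rect_def)
  qed
qed (use assms(3) in auto)

text \<open>By domination, a row of the board that meets the column \<open>j0\<close> is full, so at an unoccupied
  vertex the counts in the plane and on the board agree.\<close>

lemma iterate_plane_eq_vimage:
  fixes n m :: nat
  defines "p \<equiv> \<lambda>j0 j. if j < n then j else j0" and "q \<equiv> \<lambda>i0 i. if i < m then i else i0"
  assumes Z: "zero_set Z" and A: "A \<subseteq> rect n m"
    and j0: "j0 < n" "col A j0 = {}" and i0: "i0 < m" "row A i0 = {}"
  shows "(growth_step Z \<infinity> \<infinity> ^^ t) A =
    map_prod (p j0) (q i0) -` (growth_step Z m n ^^ t) A"
proof (induction t)
  case 0
  show ?case using A j0 i0 by (auto simp: p_def q_def rect_def split: if_splits)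
next
  case (Suc t)
  let ?S = "(growth_step Z m n ^^ t) A" and ?S' = "(growth_step Z \<infinity> \<infinity> ^^ t) A"
  have S: "?S \<subseteq> rect n m" using A by (rule iterate_subset_rect)
  have "(j, i) \<in> growth_step Z \<infinity> \<infinity> ?S' \<longleftrightarrow> (p j0 j, q i0 i) \<in> growth_step Z m n ?S" for j i
  proof (cases "(p j0 j, q i0 i) \<in> ?S")
    case True
    then show ?thesis using Suc by (simp add: growth_step_increasing)
  next
    case False
    have lt: "p j0 j < n" "q i0 i < m" using j0 i0 by (auto simp: p_def q_def)
    have "(j0, q i0 i) \<notin> ?S" "(p j0 j, i0) \<notin> ?S"
      using False lt iterate_col_dominates[OF Z A j0(2)] iterate_row_dominates[OF Z A i0(2)]
      by (metis enat_ord_simps(2))+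
    \<comment> \<open>Lines outside the board copy \<open>j0\<close> and \<open>i0\<close>; being
      unoccupied here, these copies add nothing to the counts.\<close>
    then have "row ?S' i = row ?S (q i0 i)" "col ?S' j = col ?S (p j0 j)"
      using S by (auto simp: Suc p_def q_def rect_def split: if_splits)
    then show ?thesis
      using False lt by (simp add: mem_growth_step_plane mem_growth_step[OF S] Suc rect_def)
  qed
  then show ?case by auto
qed

text \<open>The retraction maps the plane onto the board, so the preimage of a subset of the board
  is the plane exactly when the subset is the board.\<close>

lemma spans_plane_iff:
  fixes n m :: nat
  assumes "zero_set Z" "A \<subseteq> rect n m" "j0 < n" "col A j0 = {}" "i0 < m" "row A i0 = {}"
  shows "spans L Z \<infinity> \<infinity> A \<longleftrightarrow> spans L Z m n A"
proof -
  let ?f = "map_prod (\<lambda>j. if j < n then j else j0) (\<lambda>i. if i < m then i else i0)"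
  have eq: "growth Z \<infinity> \<infinity> L A = ?f -` growth Z m n L A"
    using iterate_plane_eq_vimage[OF assms] by (auto simp: growth_eq_Union)
  have sub: "growth Z m n L A \<subseteq> rect n m"
    using iterate_subset_rect[OF assms(2)] by (auto simp: growth_eq_Union)
  have "range ?f \<subseteq> rect n m" using assms by (auto simp: rect_def)
  moreover have "v = ?f v" if "v \<in> rect n m" for v
    using that by (auto simp: rect_def)
  then have "rect n m \<subseteq> range ?f" by blast
  ultimately have range: "range ?f = rect n m" by simp
  have vimage: "f -` G = UNIV \<longleftrightarrow> range f \<subseteq> G" for f :: "nat \<times> nat \<Rightarrow> nat \<times> nat" and G by blast
  show ?thesis
    unfolding spans_def eq rect_infinity vimage range using sub assms(2) by blast
qed

section \<open>Moving a finite set of the plane onto a board by permuting lines\<close>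

lemma growth_step_permute:
  assumes "bij f" "bij g"
  shows "growth_step Z \<infinity> \<infinity> (map_prod f g -` S) = map_prod f g -` growth_step Z \<infinity> \<infinity> S"
proof -
  have "ecard (row (map_prod f g -` S) i) = ecard (row S (g i))" for i
  proof -
    have "row S (g i) = f ` row (map_prod f g -` S) i"
      using bij_is_surj[OF assms(1)] by (auto simp: image_iff)
    then show ?thesis using assms(1) by (simp add: ecard_image bij_def inj_on_def)
  qed
  moreover have "ecard (col (map_prod f g -` S) j) = ecard (col S (f j))" for j
  proof -
    have "col S (f j) = g ` col (map_prod f g -` S) j"
      using bij_is_surj[OF assms(2)] by (auto simp: image_iff)
    then show ?thesis using assms(2) by (simp add: ecard_image bij_def inj_on_def)
  qed
  ultimately show ?thesis by (auto simp: mem_growth_step_plane)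
qed

lemma spans_permute:
  assumes "bij f" "bij g" "spans L Z \<infinity> \<infinity> A"
  shows "spans L Z \<infinity> \<infinity> (map_prod f g -` A)"
proof -
  have "(growth_step Z \<infinity> \<infinity> ^^ t) (map_prod f g -` A) =
      map_prod f g -` (growth_step Z \<infinity> \<infinity> ^^ t) A" for t
    by (induction t) (auto simp: growth_step_permute[OF assms(1,2)])
  then have "growth Z \<infinity> \<infinity> L (map_prod f g -` A) = map_prod f g -` growth Z \<infinity> \<infinity> L A"
    by (auto simp: growth_eq_Union)
  then show ?thesis using assms(3) by (simp add: spans_def)
qed

text \<open>A bijection from an initial segment onto X is glued to one between the two infinite
  complements.\<close>

lemma ex_bij_into_initial:
  fixes X :: "nat set"
  assumes "finite X" "card X \<le> N"
  obtains f :: "nat \<Rightarrow> nat" where "bij f" "\<And>k. f k \<in> X \<Longrightarrow> k < N"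
proof -
  obtain h where h: "bij_betw h {..<card X} X"
    using finite_same_card_bij[of "{..<card X}" X] assms(1) by auto
  define g where "g = from_nat_into (- X) \<circ> to_nat_on (- {..<card X})"
  have "infinite (- {..<card X})" "infinite (- X)"
    using assms(1) finite_compl finite_lessThan infinite_UNIV_nat by blast+
  then have g: "bij_betw g (- {..<card X}) (- X)"
    using bij_betw_trans[OF to_nat_on_infinite[of "- {..<card X}"] bij_betw_from_nat_into[of "- X"]]
    unfolding g_def by blast
  let ?f = "\<lambda>k. if k \<in> {..<card X} then h k else g k"
  have "bij_betw ?f ({..<card X} \<union> - {..<card X}) (X \<union> - X)"
    by (rule bij_betw_disjoint_Un) (use h g in auto)
  then have "bij ?f" unfolding Compl_partition .
  moreover have "k < N" if "?f k \<in> X" for k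
    using that bij_betwE[OF g] assms(2) by (auto split: if_splits)
  ultimately show thesis by (rule that)
qed

text \<open>The b rows through the block hold a vertices each and fill in the first step; afterwards
  every column holds b vertices.\<close>

lemma spans_block:
  assumes "Z \<subseteq> rect (enat a) (enat b)" "enat a \<le> n" "enat b \<le> m" "2 \<le> L"
  shows "spans L Z m n (rect (enat a) (enat b))"
proof (rule spans_iterateI[where t = 2])
  let ?A = "rect (enat a) (enat b)" and ?T = "growth_step Z m n"
  show A: "?A \<subseteq> rect n m" using assms by (auto simp: rect_def intro: order.strict_trans2[OF enat_ord_simps(2)[THEN iffD2]])
  have row: "(j, i) \<in> ?T ?A" if "i < b" "(j, i) \<in> rect n m" for j i
  proof -
    have "row ?A i = {..<a}" using that by (auto simp: rect_def)
    then have "enat a \<le> ecard (row ?A i)" by (simp add: ecard_def)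
    then show ?thesis using that by (simp add: mem_growth_step[OF A] outside_row[OF assms(1)])
  qed
  have TA: "?T ?A \<subseteq> rect n m" using A by (rule growth_step_subset_rect)
  have "(j, i) \<in> ?T (?T ?A)" if v: "(j, i) \<in> rect n m" for j i
  proof -
    have "enat k < m" if "k < b" for k using that assms(3) by (metis enat_ord_simps(2) order.strict_trans2)
    then have "{..<b} \<subseteq> col (?T ?A) j" using row v by (auto simp: rect_def)
    then have "enat b \<le> ecard (col (?T ?A) j)"
      unfolding enat_le_ecard_iff by (metis card_lessThan finite_lessThan)
    then show ?thesis using v by (simp add: mem_growth_step[OF TA] outside_col[OF assms(1)])
  qed
  then show "rect n m \<subseteq> (?T ^^ 2) ?A" by (auto simp: numeral_2_eq_2)
  show "enat 2 \<le> L" using assms(4) by (simp add: numeral_eq_enat)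
qed

lemma ecard_rect: "ecard (rect (enat a) (enat b)) = enat (a * b)"
proof -
  have "rect (enat a) (enat b) = {..<a} \<times> {..<b}" by (auto simp: rect_def)
  then show ?thesis by (simp add: ecard_def card_cartesian_product)
qed

lemma ex_empty_line:
  assumes "finite X" "card X < n" obtains k :: nat where "k < n" "k \<notin> X"
proof -
  have "\<not> {..<n} \<subseteq> X" using card_mono[OF assms(1), of "{..<n}"] assms(2) by auto
  then show thesis using that by auto
qed

lemma ecard_le_enat: "ecard A \<le> enat k \<longleftrightarrow> finite A \<and> card A \<le> k"
  by (simp add: ecard_def)

lemma ex_empty_lines:
  assumes "finite A" "card A < n" "card A < m"
  obtains j i :: nat where "j < n" "col A j = {}" "i < m" "row A i = {}"
proof -
  have "card (fst ` A) < n" "card (snd ` A) < m"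
    using card_image_le[OF assms(1), of fst] card_image_le[OF assms(1), of snd] assms by linarith+
  then obtain j i where *: "j < n" "j \<notin> fst ` A" "i < m" "i \<notin> snd ` A"
    using ex_empty_line assms(1) by (metis finite_imageI)
  then have "col A j = {}" "row A i = {}" by force+
  with * show thesis using that by blast
qed

text \<open>By \<open>spans_block\<close>, optimal sets on both sides have at most ab elements. An
  optimal set of the plane is moved into the board by permutations; an optimal set of the board has
  empty lines by counting. In both cases \<open>spans_plane_iff\<close> transfers spanning.\<close>

lemma gamma_eq_plane:
  assumes Z: "zero_set Z" "Z \<subseteq> rect (enat a) (enat b)" and ab: "1 \<le> a" "1 \<le> b"
    and "2 \<le> L" "a * b < m" "a * b < n"
  shows "gamma L Z (enat m) (enat n) = gamma L Z \<infinity> \<infinity>"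
proof (rule antisym)
  obtain A where A: "spans L Z \<infinity> \<infinity> A" "gamma L Z \<infinity> \<infinity> = ecard A" by (rule gamma_attained)
  have "ecard A \<le> enat (a * b)"
    using A(2) gamma_le[OF spans_block[OF Z(2) _ _ assms(5), of \<infinity> \<infinity>]] by (simp add: ecard_rect)
  then have fin: "finite A" "card A \<le> a * b" by (auto simp: ecard_le_enat)
  have "card (fst ` A) \<le> n - 1" "card (snd ` A) \<le> m - 1"
    using card_image_le[OF fin(1), of fst] card_image_le[OF fin(1), of snd] assms fin(2) by linarith+
  \<comment> \<open>The bounds \<open>n - 1\<close> and \<open>m - 1\<close> keep the last column
    and row of the board free, to serve as the empty lines.\<close>
  then obtain f g where f: "bij f" "\<And>k. f k \<in> fst ` A \<Longrightarrow> k < n - 1"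
    and g: "bij g" "\<And>k. g k \<in> snd ` A \<Longrightarrow> k < m - 1"
    using ex_bij_into_initial fin(1) by (metis finite_imageI)
  let ?A = "map_prod f g -` A"
  have *: "j < n - 1 \<and> i < m - 1" if "(j, i) \<in> ?A" for j i
    using that f(2)[of j] g(2)[of i] by (force simp: image_iff)
  have "spans L Z \<infinity> \<infinity> ?A" by (rule spans_permute) (use f g A in auto)
  moreover have "?A \<subseteq> rect n m" "n - 1 < n" "m - 1 < m" "col ?A (n - 1) = {}" "row ?A (m - 1) = {}"
    using * assms(6,7) by (fastforce simp: rect_def)+
  ultimately have "spans L Z m n ?A"
    using spans_plane_iff[OF Z(1)] by blast
  moreover have "ecard ?A = ecard A"
  proof -
    have "bij (map_prod f g)" using f g by (simp add: bij_def prod.inj_map map_prod_surj)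
    then have "A = map_prod f g ` ?A" by (simp add: bij_def surj_image_vimage_eq)
    then show ?thesis by (metis \<open>bij (map_prod f g)\<close> bij_def ecard_image inj_on_subset subset_UNIV)
  qed
  ultimately show "gamma L Z m n \<le> gamma L Z \<infinity> \<infinity>" using gamma_le A(2) by metis
next
  obtain A where A: "spans L Z m n A" "gamma L Z m n = ecard A" by (rule gamma_attained)
  have "a \<le> a * b" "b \<le> a * b" using ab by auto
  then have "enat a \<le> enat n" "enat b \<le> enat m"
    using assms(6,7) le_trans less_imp_le_nat by (metis enat_ord_simps(1))+
  then have "ecard A \<le> enat (a * b)"
    using A(2) gamma_le[OF spans_block[OF Z(2) _ _ assms(5)]] by (metis ecard_rect)
  then have fin: "finite A" "card A < n" "card A < m" using assms by (auto simp: ecard_le_enat)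
  then obtain j0 i0 where "j0 < n" "col A j0 = {}" "i0 < m" "row A i0 = {}"
    by (rule ex_empty_lines)
  moreover have "A \<subseteq> rect n m" using A(1) by (simp add: spans_def)
  ultimately have "spans L Z \<infinity> \<infinity> A" using spans_plane_iff[OF Z(1)] A(1) by blast
  then show "gamma L Z \<infinity> \<infinity> \<le> gamma L Z m n" using gamma_le A(2) by metis
qed

subsection \<open>The time to span the plane\<close>

abbreviation plane_step :: "(nat \<times> nat) set \<Rightarrow> (nat \<times> nat) set \<Rightarrow> (nat \<times> nat) set" where
  "plane_step Z \<equiv> growth_step Z \<infinity> \<infinity>"

lemma outside_converse: "outside (Z\<inverse>) x y \<longleftrightarrow> outside Z y x"
  by (force simp: outside_def)

text \<open>Swapping coordinates exchanges rows and columns, so all statements about columns are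
  obtained from rows of \<open>S\<inverse>\<close>.\<close>

lemma plane_step_converse: "plane_step (Z\<inverse>) (S\<inverse>) = (plane_step Z S)\<inverse>"
  by (auto simp: mem_growth_step_plane outside_converse)

lemma zero_set_converse: "zero_set Z \<Longrightarrow> zero_set (Z\<inverse>)"
  by (fastforce simp: zero_set_def)

text \<open>The cap keeps the potential bounded although the plane has infinitely many
  lines.\<close>

definition sat_card :: "nat \<Rightarrow> 'a set \<Rightarrow> nat" where
  "sat_card k X = (if finite X then min k (card X) else k)"

lemma sat_card_le: "sat_card k X \<le> k"
  by (simp add: sat_card_def)

lemma sat_card_mono: "X \<subseteq> Y \<Longrightarrow> sat_card k X \<le> sat_card k Y"
  by (auto simp: sat_card_def card_mono intro: min.coboundedI2 dest: finite_subset)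

lemma sat_card_strict_mono: "X \<subset> Y \<Longrightarrow> sat_card k X < k \<Longrightarrow> sat_card k X < sat_card k Y"
  by (auto simp: sat_card_def dest: psubset_card_mono split: if_splits)

lemma sat_card_ge_iff: "k \<le> sat_card k X \<longleftrightarrow> enat k \<le> ecard X"
  by (auto simp: sat_card_def ecard_def)

definition heavy_rows :: "nat \<Rightarrow> (nat \<times> nat) set \<Rightarrow> nat set" where
  "heavy_rows r S = {i. enat r \<le> ecard (row S i)}"

definition full_rows :: "(nat \<times> nat) set \<Rightarrow> nat set" where
  "full_rows S = {i. row S i = UNIV}"

text \<open>The sum starts at 2 because a vertex in an empty row can only be occupied
  together with its entire column.\<close>

definition row_potential :: "nat \<Rightarrow> nat \<Rightarrow> (nat \<times> nat) set \<Rightarrow> nat" where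
  "row_potential a b S =
     (\<Sum>r\<in>{2..a}. sat_card b (heavy_rows r S)) + sat_card b (full_rows S)"

lemma heavy_rows_mono: "S \<subseteq> S' \<Longrightarrow> heavy_rows r S \<subseteq> heavy_rows r S'"
  unfolding heavy_rows_def by (blast intro: order_trans ecard_mono)

lemma full_rows_mono: "S \<subseteq> S' \<Longrightarrow> full_rows S \<subseteq> full_rows S'"
  by (auto simp: full_rows_def)

lemma row_potential_mono: "S \<subseteq> S' \<Longrightarrow> row_potential a b S \<le> row_potential a b S'"
  unfolding row_potential_def
  by (intro add_mono sum_mono sat_card_mono heavy_rows_mono full_rows_mono)

text \<open>There are \<open>a - 1\<close> thresholds and the count of full rows, each contributing
  at most b.\<close>

lemma row_potential_le: "1 \<le> a \<Longrightarrow> row_potential a b S \<le> a * b"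
proof -
  assume "1 \<le> a"
  have "(\<Sum>r\<in>{2..a}. sat_card b (heavy_rows r S)) \<le> card {2..a} * b"
    using sum_bounded_above[of "{2..a}" "\<lambda>r. sat_card b (heavy_rows r S)" b]
    by (simp add: sat_card_le)
  also have "\<dots> + b = a * b" using \<open>1 \<le> a\<close> by (cases a) auto
  finally show ?thesis unfolding row_potential_def
    using sat_card_le[of b "full_rows S"] by linarith
qed

lemma row_potential_strict_full:
  assumes "S \<subseteq> S'" "i \<in> full_rows S'" "i \<notin> full_rows S" "sat_card b (full_rows S) < b"
  shows "row_potential a b S < row_potential a b S'"
  unfolding row_potential_def
proof (rule add_le_less_mono)
  show "sat_card b (full_rows S) < sat_card b (full_rows S')"
    using assms full_rows_mono[OF assms(1)] by (intro sat_card_strict_mono) auto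
qed (intro sum_mono sat_card_mono heavy_rows_mono assms)

lemma row_potential_strict_heavy:
  assumes "S \<subseteq> S'" "2 \<le> r" "r \<le> a" "i \<in> heavy_rows r S'" "i \<notin> heavy_rows r S"
    and "sat_card b (heavy_rows r S) < b"
  shows "row_potential a b S < row_potential a b S'"
  unfolding row_potential_def
proof (rule add_less_le_mono)
  show "(\<Sum>r\<in>{2..a}. sat_card b (heavy_rows r S)) < (\<Sum>r\<in>{2..a}. sat_card b (heavy_rows r S'))"
  proof (rule sum_strict_mono_ex1)
    show "\<exists>r\<in>{2..a}. sat_card b (heavy_rows r S) < sat_card b (heavy_rows r S')"
      using assms heavy_rows_mono[OF assms(1)]
      by (intro bexI[of _ r] sat_card_strict_mono) auto
  qed (simp_all add: sat_card_mono heavy_rows_mono[OF assms(1)])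
qed (intro sat_card_mono full_rows_mono assms)

text \<open>The full rows put b occupied vertices into every column.\<close>

lemma plane_step_full_rows:
  assumes "Z \<subseteq> rect (enat a) (enat b)" "enat b \<le> ecard (full_rows S)"
  shows "plane_step Z S = UNIV"
proof -
  have "enat b \<le> ecard (col S j)" for j
  proof -
    have "full_rows S \<subseteq> col S j" by (auto simp: full_rows_def)
    then show ?thesis using assms(2) ecard_mono order_trans by blast
  qed
  then show ?thesis using outside_col[OF assms(1)] by (auto simp: mem_growth_step_plane)
qed

lemma full_row_if_outside:
  assumes "zero_set Z" "outside Z (ecard (row S i)) 0"
  shows "i \<in> full_rows (plane_step Z S)"
  using outside_mono[OF assms order_refl zero_le]
  by (auto simp: full_rows_def mem_growth_step_plane)

text \<open>The row count alone suffices, so the whole row fills at once. This is a new full row,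
  which raises the potential unless there are b full rows already, and then the plane fills.\<close>

lemma row_potential_increases:
  assumes Z: "zero_set Z" "Z \<subseteq> rect (enat a) (enat b)"
    and v: "(j, i) \<notin> S" "outside Z (ecard (row S i)) 0"
  shows "row_potential a b S < row_potential a b (plane_step Z S) \<or> plane_step Z S = UNIV"
proof (cases "sat_card b (full_rows S) < b")
  case True
  have "i \<notin> full_rows S" using v(1) by (auto simp: full_rows_def)
  then show ?thesis
    using row_potential_strict_full[OF _ full_row_if_outside[OF Z(1) v(2)] _ True]
    by (blast intro: growth_step_increasing)
next
  case False
  then show ?thesis
    using plane_step_full_rows[OF Z(2)] by (simp add: not_less sat_card_ge_iff)
qed

lemma converse_eq_UNIV_iff: "S\<inverse> = UNIV \<longleftrightarrow> S = UNIV"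
  by (metis converse_UNIV converse_converse)

lemma heavy_rows_insert:
  assumes "(j, i) \<in> S'" "(j, i) \<notin> S" "S \<subseteq> S'" "ecard (row S i) = enat r"
  shows "i \<in> heavy_rows (Suc r) S'" "i \<notin> heavy_rows (Suc r) S"
proof -
  have "ecard (insert j (row S i)) = enat (Suc r)"
    using assms(2,4) by (auto simp: ecard_def split: if_splits)
  moreover have "insert j (row S i) \<subseteq> row S' i" using assms by auto
  ultimately show "i \<in> heavy_rows (Suc r) S'"
    unfolding heavy_rows_def by (metis ecard_mono mem_Collect_eq)
qed (simp add: heavy_rows_def assms(4))

text \<open>The crossings of the heavy rows with the heavy columns are occupied after one step. The
  heavy rows then hold a vertices each and are full after the second step, and the third fills the
  plane.\<close>

lemma plane_step_grid:
  assumes Z: "zero_set Z" "Z \<subseteq> rect (enat a) (enat b)" and out: "outside Z (enat r) (enat c)"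
    and rows: "enat b \<le> ecard (heavy_rows r S)" and cols: "enat a \<le> ecard (heavy_rows c (S\<inverse>))"
  shows "(plane_step Z ^^ 3) S = UNIV"
proof -
  let ?T = "plane_step Z"
  have grid: "(j, i) \<in> ?T S" if "i \<in> heavy_rows r S" "j \<in> heavy_rows c (S\<inverse>)" for j i
    using that outside_mono[OF Z(1) out] by (simp add: heavy_rows_def mem_growth_step_plane)
  have "heavy_rows r S \<subseteq> full_rows (?T (?T S))"
  proof
    fix i assume "i \<in> heavy_rows r S"
    then have "heavy_rows c (S\<inverse>) \<subseteq> row (?T S) i" using grid by auto
    then have "enat a \<le> ecard (row (?T S) i)" using cols ecard_mono order_trans by blast
    then show "i \<in> full_rows (?T (?T S))"
      using Z by (intro full_row_if_outside outside_row)
  qed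
  then have "enat b \<le> ecard (full_rows (?T (?T S)))" using rows ecard_mono order_trans by blast
  then show ?thesis using plane_step_full_rows[OF Z(2)] by (simp add: numeral_3_eq_3)
qed

definition potential :: "nat \<Rightarrow> nat \<Rightarrow> (nat \<times> nat) set \<Rightarrow> nat" where
  "potential a b S = row_potential a b S + row_potential b a (S\<inverse>)"

lemma plane_step_UNIV [simp]: "plane_step Z UNIV = UNIV"
  by (auto intro: growth_step_increasing)

text \<open>A new vertex is due to its row count alone, to its column count alone, or to both
  jointly. In the first two cases an entire line fills. In the third its row and column each gain a
  vertex, which raises a count unless both relevant counts are at their caps, and then a grid
  appears.\<close>

lemma plane_step_trichotomy:
  assumes Z: "zero_set Z" "Z \<subseteq> rect (enat a) (enat b)" and ne: "plane_step Z S \<noteq> S"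
  shows "potential a b S < potential a b (plane_step Z S) \<or> (plane_step Z ^^ 3) S = UNIV"
proof -
  let ?T = "plane_step Z"
  have sub: "S \<subseteq> ?T S" "S\<inverse> \<subseteq> (?T S)\<inverse>" by (auto intro: growth_step_increasing)
  have U: "(?T ^^ 3) S = UNIV" if "?T S = UNIV" using that by (simp add: numeral_3_eq_3)
  have row_lt: "potential a b S < potential a b (?T S)" if "row_potential a b S < row_potential a b (?T S)"
    using that row_potential_mono[OF sub(2), of b a] by (simp add: potential_def)
  have col_lt: "potential a b S < potential a b (?T S)"
    if "row_potential b a (S\<inverse>) < row_potential b a ((?T S)\<inverse>)"
    using that row_potential_mono[OF sub(1), of a b] by (simp add: potential_def)
  obtain j i where v: "(j, i) \<in> ?T S" "(j, i) \<notin> S" using ne sub(1) by auto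
  let ?r = "ecard (row S i)" and ?c = "ecard (col S j)"
  have out: "outside Z ?r ?c" using v by (simp add: mem_growth_step_plane)
  show ?thesis
  proof (cases "outside Z ?r 0 \<or> outside Z 0 ?c")
    case True
    then show ?thesis
    proof
      assume "outside Z ?r 0"
      then show ?thesis using row_potential_increases[OF Z v(2)] row_lt U by blast
    next
      assume "outside Z 0 ?c"
      moreover have "Z\<inverse> \<subseteq> rect (enat b) (enat a)" using Z(2) by (auto simp: rect_def)
      ultimately show ?thesis
        using row_potential_increases[OF zero_set_converse[OF Z(1)], of b a i j "S\<inverse>"] v(2) col_lt U
        by (auto simp: outside_converse plane_step_converse converse_eq_UNIV_iff)
    qed
  next
    case False
    \<comment> \<open>Neither count suffices alone, so both are finite and positive. Hence
      \<open>Suc r\<close> and \<open>Suc c\<close> are at least 2 and belong to the thresholds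
      counted by the potential.\<close>
    then have "\<not> enat a \<le> ?r" "\<not> enat b \<le> ?c" "?r \<noteq> 0" "?c \<noteq> 0"
      using out outside_row[OF Z(2)] outside_col[OF Z(2)] by auto
    then obtain r c where rc: "?r = enat r" "?c = enat c" "1 \<le> r" "1 \<le> c" "r < a" "c < b"
      by (cases ?r; cases ?c) (auto simp: zero_enat_def)
    have r: "i \<in> heavy_rows (Suc r) (?T S)" "i \<notin> heavy_rows (Suc r) S"
      using heavy_rows_insert[OF v sub(1) rc(1)] .
    have c: "j \<in> heavy_rows (Suc c) ((?T S)\<inverse>)" "j \<notin> heavy_rows (Suc c) (S\<inverse>)"
      using heavy_rows_insert[of i j "(?T S)\<inverse>" "S\<inverse>" c] v sub(2) rc(2) by auto
    show ?thesis
    proof (cases "sat_card b (heavy_rows (Suc r) S) < b \<or> sat_card a (heavy_rows (Suc c) (S\<inverse>)) < a")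
      case True
      then show ?thesis
        using row_potential_strict_heavy[OF sub(1) _ _ r] row_potential_strict_heavy[OF sub(2) _ _ c]
          row_lt col_lt rc by auto
    next
      case False
      \<comment> \<open>The caps are reached at the thresholds \<open>Suc r\<close> and
        \<open>Suc c\<close>, while the grid needs r and c, the pair known to be outside Z.\<close>
      moreover have "heavy_rows (Suc k) X \<subseteq> heavy_rows k X" for k X
        by (auto simp: heavy_rows_def elim: order_trans[rotated])
      ultimately have "enat b \<le> ecard (heavy_rows r S)" "enat a \<le> ecard (heavy_rows c (S\<inverse>))"
        unfolding not_less sat_card_ge_iff de_Morgan_disj
        by (meson ecard_mono order_trans)+
      then show ?thesis using plane_step_grid[OF Z, of r c S] out rc by auto
    qed
  qed
qed

text \<open>The potential is at most 2ab, so it fails to increase at some time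
  \<open>t \<le> 2 * a * b\<close>. Either growth has stopped there, and a spanning set has already
  filled the plane, or three more steps fill it.\<close>

lemma spanning_time_le:
  assumes Z: "zero_set Z" "Z \<subseteq> rect (enat a) (enat b)" and ab: "1 \<le> a" "1 \<le> b"
    and A: "spans \<infinity> Z \<infinity> \<infinity> A" and L: "enat (2 * a * b + 3) \<le> L"
  shows "spans L Z \<infinity> \<infinity> A"
proof -
  let ?T = "\<lambda>t. (plane_step Z ^^ t) A"
  have full: "(\<Union>t. ?T t) = UNIV" using A by (simp add: spans_def growth_eq_Union)
  have "\<exists>t \<le> 2 * a * b. \<not> potential a b (?T t) < potential a b (?T (Suc t))"
  proof (rule ccontr)
    assume *: "\<not> ?thesis"
    have "t \<le> potential a b (?T t)" if "t \<le> Suc (2 * a * b)" for t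
      using that by (induction t) (use * in \<open>fastforce+\<close>)
    from this[of "Suc (2 * a * b)"] show False
      using row_potential_le[OF ab(1), of b "?T (Suc (2 * a * b))"]
        row_potential_le[OF ab(2), of a "(?T (Suc (2 * a * b)))\<inverse>"]
      by (simp add: potential_def algebra_simps)
  qed
  then obtain t where t: "t \<le> 2 * a * b" "\<not> potential a b (?T t) < potential a b (?T (Suc t))" by blast
  have "?T (t + 3) = UNIV"
  proof (cases "?T (Suc t) = ?T t")
    case True
    then have stable: "?T (s + t) = ?T t" for s by (induction s) auto
    have "?T s \<subseteq> ?T t" for s
      using stable[of s] iterate_mono_time[of s "s + t" Z \<infinity> \<infinity> A] by simp
    then have "?T t = UNIV" using full by (metis UN_least top.extremum_uniqueI)
    then show ?thesis using stable[of 3] by (simp add: add.commute)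
  next
    case False
    then have "(plane_step Z ^^ 3) (?T t) = UNIV"
      using plane_step_trichotomy[OF Z, of "?T t"] t(2) by simp
    then show ?thesis by (metis add.commute comp_apply funpow_add)
  qed
  moreover have "enat (t + 3) \<le> L" using t(1) L by (metis add_le_mono1 enat_ord_simps(1) order_trans)
  ultimately show ?thesis by (intro spans_iterateI[where t = "t + 3"]) auto
qed

lemma gamma_plane_eq_infinity:
  assumes "zero_set Z" "Z \<subseteq> rect (enat a) (enat b)" "1 \<le> a" "1 \<le> b" "enat (2 * a * b + 3) \<le> L"
  shows "gamma L Z \<infinity> \<infinity> = gamma \<infinity> Z \<infinity> \<infinity>"
proof (rule antisym)
  obtain A where "spans \<infinity> Z \<infinity> \<infinity> A" "gamma \<infinity> Z \<infinity> \<infinity> = ecard A" by (rule gamma_attained)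
  then show "gamma L Z \<infinity> \<infinity> \<le> gamma \<infinity> Z \<infinity> \<infinity>"
    using gamma_le spanning_time_le assms by metis
qed (simp add: gamma_antimono)

subsection \<open>The extremal size in terms of the area of the zero-set\<close>

lemma finite_rect: "A \<subseteq> rect (enat a) (enat b) \<Longrightarrow> finite A"
  by (rule finite_subset[of _ "{..<a} \<times> {..<b}"]) (auto simp: rect_def)

lemma finite_row: "finite A \<Longrightarrow> finite (row A i)"
  by (rule finite_subset[OF _ finite_imageI[of A fst]]) force+

lemma finite_col: "finite A \<Longrightarrow> finite (col A j)"
  using finite_row[of "A\<inverse>" j] by simp

text \<open>The rows fill one after another: when the first t rows are full, every column holds t
  vertices, and row t still holds its row of Z, whose length together with t is a pair outside
  Z.\<close>

lemma spans_zero_set: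
  assumes Z: "zero_set Z" "Z \<subseteq> rect (enat a) (enat b)"
  shows "spans \<infinity> Z \<infinity> \<infinity> Z"
proof -
  let ?T = "\<lambda>t. (plane_step Z ^^ t) Z"
  have fin: "finite Z" using Z(2) by (rule finite_rect)
  have filled: "(j, i) \<in> ?T t" if "i < t" for j i t
    using that
  proof (induction t arbitrary: i j)
    case (Suc t)
    show ?case
    proof (cases "i < t")
      case True
      then show ?thesis using Suc.IH by (simp add: growth_step_increasing)
    next
      case False
      with Suc.prems have [simp]: "i = t" by simp
      have fr: "finite (row Z t)" using fin by (rule finite_row)
      \<comment> \<open>This segment has one element more than the row, so it contains a gap;
        downward closure carries the gap to the endpoint.\<close>
      have "\<not> {..card (row Z t)} \<subseteq> row Z t"
        using card_mono[OF fr, of "{..card (row Z t)}"] by auto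
      then obtain x where "x \<le> card (row Z t)" "(x, t) \<notin> Z" by auto
      then have "(card (row Z t), t) \<notin> Z" using zero_setD[OF Z(1)] by blast
      then have "outside Z (enat (card (row Z t))) (enat t)" by simp
      moreover have "enat (card (row Z t)) \<le> ecard (row (?T t) t)"
        unfolding enat_le_ecard_iff using iterate_mono_time[of 0 t Z \<infinity> \<infinity> Z] fr
        by (intro exI[of _ "row Z t"]) auto
      moreover have "enat t \<le> ecard (col (?T t) j)"
        using Suc.IH by (auto simp: enat_le_ecard_iff intro!: exI[of _ "{..<t}"])
      ultimately have "outside Z (ecard (row (?T t) t)) (ecard (col (?T t) j))"
        by (rule outside_mono[OF Z(1)])
      then show ?thesis by (simp add: mem_growth_step_plane)
    qed
  qed simp
  have "(j, i) \<in> (\<Union>t. ?T t)" for j i using filled[of i "Suc i" j] by blast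
  then show ?thesis by (auto simp: spans_def growth_eq_Union)
qed

text \<open>Consider the first vertex outside A that gets occupied away from all columns with more than
  s and all rows with more than p vertices of A.\<close>

lemma spans_outside:
  assumes Z: "zero_set Z" and A: "finite A" "spans \<infinity> Z \<infinity> \<infinity> A"
  shows "(p + card {j. s < card (col A j)}, s + card {i. p < card (row A i)}) \<notin> Z"
proof -
  let ?T = "\<lambda>t. (plane_step Z ^^ t) A"
  let ?Y = "{j. s < card (col A j)}" and ?X = "{i. p < card (row A i)}"
  have frow: "finite (row A i)" for i using A(1) by (rule finite_row)
  have fcol: "finite (col A j)" for j using A(1) by (rule finite_col)
  have "?Y \<subseteq> fst ` A"
  proof
    fix j assume "j \<in> ?Y"
    then have "col A j \<noteq> {}" by force
    then show "j \<in> fst ` A" by force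
  qed
  then have fY: "finite ?Y" using A(1) finite_subset by blast
  have "?X \<subseteq> snd ` A"
  proof
    fix i assume "i \<in> ?X"
    then have "row A i \<noteq> {}" by force
    then show "i \<in> snd ` A" by force
  qed
  then have fX: "finite ?X" using A(1) finite_subset by blast
  \<comment> \<open>A with all its heavy lines filled in. Finitely many lines do not cover the
    plane, so the growth must leave B.\<close>
  define B where "B = A \<union> {(j, i). j \<in> ?Y \<or> i \<in> ?X}"
  obtain j0 where j0: "j0 \<notin> fst ` A \<union> ?Y" using A(1) fY ex_new_if_finite[OF infinite_UNIV_nat] by (metis finite_UnI finite_imageI)
  obtain i0 where i0: "i0 \<notin> ?X" using fX ex_new_if_finite[OF infinite_UNIV_nat] by metis
  have "(j0, i0) \<notin> B" using j0 i0 by (force simp: B_def)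
  moreover have "(j0, i0) \<in> (\<Union>t. ?T t)" using A(2) by (simp add: spans_def growth_eq_Union)
  ultimately obtain u where "\<not> ?T u \<subseteq> B" by blast
  then have ex: "\<exists>t. ?T t \<subseteq> B \<and> \<not> ?T (Suc t) \<subseteq> B"
  proof (induction u)
    case (Suc u)
    then show ?case by (cases "?T u \<subseteq> B") blast+
  qed (auto simp: B_def)
  then obtain t where t: "?T t \<subseteq> B" "\<not> ?T (Suc t) \<subseteq> B" by blast
  then obtain j i where v: "(j, i) \<in> ?T (Suc t)" "(j, i) \<notin> B" by auto
  then have out: "outside Z (ecard (row (?T t) i)) (ecard (col (?T t) j))"
    using t(1) by (auto simp: mem_growth_step_plane)
  \<comment> \<open>Before the exit only B is occupied. The row of v is light, so it holds at most p
    vertices of A and one vertex per heavy column; likewise for its column.\<close>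
  have "row (?T t) i \<subseteq> row A i \<union> ?Y" "col (?T t) j \<subseteq> col A j \<union> ?X"
    using t(1) v(2) by (auto simp: B_def)
  moreover have "card (row A i \<union> ?Y) \<le> p + card ?Y" "card (col A j \<union> ?X) \<le> s + card ?X"
    using v(2) card_Un_le[of "row A i" ?Y] card_Un_le[of "col A j" ?X] by (auto simp: B_def)
  ultimately have "ecard (row (?T t) i) \<le> enat (p + card ?Y)"
    "ecard (col (?T t) j) \<le> enat (s + card ?X)"
    using frow fcol fX fY
    by (meson ecard_le_enat ecard_mono finite_UnI order_trans)+
  from outside_mono[OF Z out this] show ?thesis by simp
qed

text \<open>Double counting of the pairs (s, x) with s < f x; the diagram formed is that of the
  conjugate partition.\<close>

lemma card_conjugate:
  fixes f :: "'a \<Rightarrow> nat"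
  assumes "finite X" "\<And>x. x \<notin> X \<Longrightarrow> f x = 0"
  shows "finite (SIGMA s:UNIV. {..<card {x. s < f x}})"
    and "card (SIGMA s:UNIV. {..<card {x. s < f x}}) = sum f X"
proof -
  define N where "N = Suc (sum f X)"
  have N: "f x \<le> N" if "x \<in> X" for x
    using member_le_sum[OF that, of f] assms(1) by (simp add: N_def)
  have X: "{x. s < f x} = {x \<in> X. s < f x}" for s using assms(2) by force
  have emp: "{x. s < f x} = {}" if "N \<le> s" for s using N that unfolding X by fastforce
  have eq: "(SIGMA s:UNIV. {..<card {x. s < f x}}) = (SIGMA s:{..<N}. {..<card {x. s < f x}})"
    using emp by (auto simp: lessThan_iff not_less simp flip: not_le)
  show "finite (SIGMA s:UNIV. {..<card {x. s < f x}})" unfolding eq by auto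
  have "card (SIGMA s:UNIV. {..<card {x. s < f x}}) = (\<Sum>s<N. card {x \<in> X. s < f x})"
    unfolding eq by (simp add: X)
  also have "\<dots> = (\<Sum>s<N. \<Sum>x\<in>X. if s < f x then 1 else 0)"
    using assms(1) by (simp add: sum.If_cases Int_def)
  also have "\<dots> = (\<Sum>x\<in>X. \<Sum>s<N. if s < f x then 1 else 0)" by (rule sum.swap)
  also have "\<dots> = (\<Sum>x\<in>X. f x)"
  proof (rule sum.cong[OF refl])
    fix x assume "x \<in> X"
    then have "{..<N} \<inter> {s. s < f x} = {..<f x}" using N by fastforce
    then show "(\<Sum>s<N. if s < f x then 1 else 0) = f x" by (simp add: sum.If_cases)
  qed
  finally show "card (SIGMA s:UNIV. {..<card {x. s < f x}}) = sum f X" .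
qed

lemma sum_card_row: "finite A \<Longrightarrow> (\<Sum>i\<in>snd ` A. card (row A i)) = card A"
proof -
  assume A: "finite A"
  have "card A = card (A\<inverse>)" by (simp add: card_inverse)
  also have "A\<inverse> = (SIGMA i:snd ` A. row A i)" by force
  also have "card \<dots> = (\<Sum>i\<in>snd ` A. card (row A i))"
    using A by (simp add: finite_row)
  finally show ?thesis by simp
qed

lemma sum_card_col: "finite A \<Longrightarrow> (\<Sum>j\<in>fst ` A. card (col A j)) = card A"
  using sum_card_row[of "A\<inverse>"]
  by (simp add: card_inverse Domain_fst[symmetric] Range_snd[symmetric])

text \<open>Row y of Z has length at most p + d(s) whenever s + e(p) \<open>\<le>\<close> y. Splitting y evenly between
  s and e(p) uses every value of either part for at most two y, hence the factor 4.\<close>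

lemma card_zero_set_le:
  assumes Z: "zero_set Z" and A: "finite A" "spans \<infinity> Z \<infinity> \<infinity> A"
  shows "card Z \<le> 4 * card A"
proof -
  define d where "d s = card {j. s < card (col A j)}" for s
  define e where "e p = card {i. p < card (row A i)}" for p
  define E where "E = (SIGMA p:UNIV. {..<e p})"
  define D where "D = (SIGMA s:UNIV. {..<d s})"
  have "card (row A i) = 0" if "i \<notin> snd ` A" for i
    using that by (force simp: card_eq_0_iff)
  then have E: "finite E" "card E = card A"
    using card_conjugate[of "snd ` A" "\<lambda>i. card (row A i)"] A(1)
    by (auto simp: E_def e_def sum_card_row)
  have "card (col A j) = 0" if "j \<notin> fst ` A" for j
    using that by (force simp: card_eq_0_iff)
  then have D: "finite D" "card D = card A"
    using card_conjugate[of "fst ` A" "\<lambda>j. card (col A j)"] A(1)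
    by (auto simp: D_def d_def sum_card_col)
  define \<rho> where "\<rho> i = (LEAST p. e p \<le> i)" for i
  \<comment> \<open>A threshold beyond the finite projection of E has \<open>e p0 = 0\<close>, so
    the minimum defining \<open>\<rho>\<close> exists.\<close>
  have "finite (fst ` E)" using E(1) by simp
  then obtain p0 where "p0 \<notin> fst ` E" using ex_new_if_finite[OF infinite_UNIV_nat] by blast
  then have "e p0 = 0" by (force simp: E_def)
  then have e_\<rho>: "e (\<rho> i) \<le> i" for i
    unfolding \<rho>_def using LeastI[of "\<lambda>p. e p \<le> i" p0] by simp
  have e_less: "i < e p" if "p < \<rho> i" for p i
    using that not_less_Least unfolding \<rho>_def by (metis not_le)
  \<comment> \<open>Row y of Z is cut at \<open>\<rho> (y div 2)\<close>. The left part goes to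
    height \<open>y div 2\<close> of E, the rest is shifted into D at
    \<open>s = (y + 1) div 2\<close>; the parity of y makes y recoverable.\<close>
  define f where "f = (\<lambda>(x, y). if x < \<rho> (y div 2) then Inl ((x, y div 2), y mod 2)
    else Inr (((y + 1) div 2, x - \<rho> (y div 2)), y mod 2))"
  have halves: "y div 2 + (y + 1) div 2 = y" for y :: nat by presburger
  have "f ` Z \<subseteq> (E \<times> {..<2}) <+> (D \<times> {..<2})"
  proof
    fix w assume "w \<in> f ` Z"
    then obtain x y where xy: "(x, y) \<in> Z" "w = f (x, y)" by auto
    show "w \<in> (E \<times> {..<2}) <+> (D \<times> {..<2})"
    proof (cases "x < \<rho> (y div 2)")
      case True
      then show ?thesis using e_less xy(2) by (auto simp: f_def E_def)
    next
      case False
      let ?s = "(y + 1) div 2"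
      \<comment> \<open>The second coordinate is at most y, as the two halves of y add up to y.
        Since (x, y) is in Z, the first coordinate must exceed x.\<close>
      have "(\<rho> (y div 2) + d ?s, ?s + e (\<rho> (y div 2))) \<notin> Z"
        using spans_outside[OF Z A] by (simp add: d_def e_def)
      then have "\<not> (\<rho> (y div 2) + d ?s \<le> x \<and> ?s + e (\<rho> (y div 2)) \<le> y)"
        using Z xy(1) unfolding zero_set_def by blast
      moreover have "?s + e (\<rho> (y div 2)) \<le> y" using e_\<rho>[of "y div 2"] halves[of y] by linarith
      ultimately have "x - \<rho> (y div 2) < d ?s" using False by linarith
      then show ?thesis using False xy(2) by (auto simp: f_def D_def)
    qed
  qed
  moreover have "inj f"
  proof (rule injI)
    fix v w assume eq: "f v = f w"
    obtain x y where v: "v = (x, y)" by (cases v)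
    obtain x' y' where w: "w = (x', y')" by (cases w)
    have "(u + 1) div 2 = u div 2 + u mod 2" for u :: nat by presburger
    then have "y mod 2 = y' mod 2 \<and> y div 2 = y' div 2"
      using eq by (auto simp: f_def v w split: if_splits)
    then have "y = y'" by (metis div_mult_mod_eq)
    then show "v = w" using eq by (auto simp: f_def v w split: if_splits)
  qed
  ultimately have "card Z \<le> card ((E \<times> {..<2::nat}) <+> (D \<times> {..<2::nat}))"
    using E(1) D(1) by (intro card_inj_on_le[of f]) (auto intro: inj_on_subset)
  also have "\<dots> = 4 * card A"
    using E D by (simp add: card_Plus card_cartesian_product)
  finally show ?thesis .
qed

lemma gamma_infinity_bounds:
  assumes Z: "zero_set Z" "Z \<subseteq> rect (enat a) (enat b)"
  shows "ereal_of_enat (gamma \<infinity> Z \<infinity> \<infinity>) \<in> {ereal (real (card Z) / 4) .. ereal (real (card Z))}"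
proof -
  have fin: "finite Z" using Z(2) by (rule finite_rect)
  obtain A where A: "spans \<infinity> Z \<infinity> \<infinity> A" "gamma \<infinity> Z \<infinity> \<infinity> = ecard A" by (rule gamma_attained)
  have "ecard A \<le> enat (card Z)"
    using gamma_le[OF spans_zero_set[OF Z]] A(2) fin by (simp add: ecard_def)
  then have "finite A" "card A \<le> card Z" by (simp_all add: ecard_le_enat)
  moreover from this have "card Z \<le> 4 * card A" using card_zero_set_le[OF Z(1) _ A(1)] by simp
  moreover have "ereal_of_enat (gamma \<infinity> Z \<infinity> \<infinity>) = ereal (real (card A))"
    using \<open>finite A\<close> by (simp add: A(2) ecard_def)
  ultimately show ?thesis by (simp add: field_simps)
qed

subsection \<open>Unbounded ratios\<close>

text \<open>The ratio is at least k / 4 along the family. The origin lies in every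
  \<open>Z k\<close>, so the empty set never grows and the denominators are positive. The factor 4
  leaves room for the constant in the cross example.\<close>

lemma growth_ratio_unbounded:
  assumes "\<And>k. 1 \<le> k \<Longrightarrow> finite (Z k) \<and> zero_set (Z k) \<and> (0, 0) \<in> Z k \<and> 1 \<le> N k"
    and lower: "\<And>k. 1 \<le> k \<Longrightarrow> enat (k * c k) \<le> gamma L (Z k) (enat (N k)) (enat (N k))"
    and upper: "\<And>k. 1 \<le> k \<Longrightarrow> gamma L' (Z k) (enat (N k)) (enat (N k)) \<le> enat (4 * c k)"
  shows "(SUP (Z, m, n) \<in> {(Z :: (nat \<times> nat) set, m :: nat, n :: nat).
                         finite Z \<and> zero_set Z \<and> 1 \<le> m \<and> 1 \<le> n \<and>
                         0 < gamma L' Z (enat m) (enat n)}.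
         ereal_of_enat (gamma L Z (enat m) (enat n)) /
         ereal_of_enat (gamma L' Z (enat m) (enat n))) = \<infinity>"
    (is "Sup (?f ` ?I) = _")
proof -
  have "\<exists>z\<in>?I. ereal (real k) \<le> ?f z" for k :: nat
  proof -
    \<comment> \<open>A ratio of at least K / 4 then exceeds k, and K is positive even for k =
      0.\<close>
    define K where "K = 4 * Suc k"
    have K: "1 \<le> K" by (simp add: K_def)
    let ?Z = "Z K" and ?N = "enat (N K)"
    have props: "finite ?Z" "zero_set ?Z" "(0, 0) \<in> ?Z" "1 \<le> N K"
      using assms(1)[OF K] by auto
    have stuck: "(growth_step ?Z ?N ?N ^^ t) {} = {}" for t
    proof (induction t)
      case (Suc t)
      then show ?case
        using props(3) by (auto simp: mem_growth_step outside_def zero_enat_def)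
    qed simp
    have pos: "0 < gamma L' ?Z ?N ?N"
    proof (rule ccontr)
      assume "\<not> ?thesis"
      moreover obtain A where A: "spans L' ?Z ?N ?N A" "gamma L' ?Z ?N ?N = ecard A"
        by (rule gamma_attained)
      ultimately have "A = {}" by (auto simp: ecard_def zero_enat_def split: if_splits)
      with A have "rect ?N ?N = {}" by (auto simp: spans_def growth_eq_Union stuck)
      then show False using props(4) by (auto simp: rect_def dest: spec[of _ 0])
    qed
    obtain h where h: "gamma L' ?Z ?N ?N = enat h" "h \<le> 4 * c K"
      using upper[OF K] by (cases "gamma L' ?Z ?N ?N") auto
    have h0: "0 < h" using pos h(1) by (simp add: zero_enat_def)
    have "real k * real h \<le> real (K * c K)"
    proof -
      have "k * h \<le> k * (4 * c K)" using h(2) by simp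
      also have "\<dots> \<le> K * c K" by (simp add: K_def)
      finally show ?thesis by (metis of_nat_le_iff of_nat_mult)
    qed
    then have "ereal (real k * real h) \<le> ereal_of_enat (enat (K * c K))" by simp
    also have "\<dots> \<le> ereal_of_enat (gamma L ?Z ?N ?N)" using lower[OF K] by (simp only: ereal_of_enat_le_iff)
    finally have "ereal (real k) \<le> ereal_of_enat (gamma L ?Z ?N ?N) / ereal_of_enat (gamma L' ?Z ?N ?N)"
      using h0 by (simp add: h(1) ereal_le_divide_pos mult.commute)
    then show ?thesis using props pos by (intro bexI[of _ "(?Z, N K, N K)"]) auto
  qed
  then have "ereal (real k) \<le> Sup (?f ` ?I)" for k :: nat
    by (meson SUP_upper2)
  then show ?thesis by (meson less_PInf_Ex_of_nat linorder_not_less)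
qed

section \<open>The ratios for L = 0 and L = 1 from the one-point zero-set\<close>

lemma zero_set_origin: "zero_set {(0, 0)}"
  by (simp add: zero_set_def)

lemma outside_origin: "outside {(0, 0)} x y \<longleftrightarrow> x \<noteq> 0 \<or> y \<noteq> 0"
  by (auto simp: outside_def zero_enat_def)

lemma ecard_eq_0_iff [simp]: "ecard X = 0 \<longleftrightarrow> X = {}"
  by (auto simp: ecard_def zero_enat_def)

lemma gamma_0: "gamma 0 Z (enat k) (enat k) = enat (k * k)"
proof -
  obtain A where "spans 0 Z (enat k) (enat k) A" "gamma 0 Z (enat k) (enat k) = ecard A" by (rule gamma_attained)
  then show ?thesis by (simp add: spans_def growth_def zero_enat_def ecard_rect)
qed

text \<open>A full row meets every column.\<close>

lemma gamma_1_origin_le: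
  assumes "1 \<le> k"
  shows "gamma 1 {(0, 0)} (enat k) (enat k) \<le> enat k"
proof -
  let ?A = "rect (enat k) (enat 1)"
  have A: "?A \<subseteq> rect k k" using assms by (auto simp: rect_def)
  have "(j, i) \<in> growth_step {(0, 0)} k k ?A" if "(j, i) \<in> rect k k" for j i
  proof -
    have "(j, 0) \<in> ?A" using that by (simp add: rect_def)
    then have "col ?A j \<noteq> {}" by blast
    then have "outside {(0, 0)} (ecard (row ?A i)) (ecard (col ?A j))"
      unfolding outside_origin by simp
    then show ?thesis using that by (simp only: mem_growth_step[OF A] simp_thms)
  qed
  then have "spans 1 {(0, 0)} k k ?A"
    by (intro spans_iterateI[OF A, where t = 1]) (auto simp: one_enat_def)
  then show ?thesis using gamma_le by (metis ecard_rect mult_1_right)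
qed

text \<open>Fewer than k vertices leave an empty row and an empty column, whose crossing sees no
  occupied vertex.\<close>

lemma gamma_1_origin_ge: "enat k \<le> gamma 1 {(0, 0)} (enat k) (enat k)"
proof (rule le_gammaI, rule ccontr)
  fix A assume A: "spans 1 {(0, 0)} k k A" "\<not> enat k \<le> ecard A"
  have sub: "A \<subseteq> rect k k" using A(1) by (simp add: spans_def)
  then have fin: "finite A" "card A < k" using A(2) finite_rect by (auto simp: ecard_def)
  from fin(1) fin(2) fin(2) obtain j i where ji: "j < k" "col A j = {}" "i < k" "row A i = {}"
    by (rule ex_empty_lines)
  then have "(j, i) \<in> growth_step {(0, 0)} k k A"
    using A(1) by (simp add: spans_def growth_def one_enat_def rect_def)
  then show False using ji by (auto simp: mem_growth_step[OF sub] outside_origin)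
qed

text \<open>A single vertex is a 1-by-1 block.\<close>

lemma gamma_2_origin_le: "1 \<le> k \<Longrightarrow> gamma 2 {(0, 0)} (enat k) (enat k) \<le> 1"
proof -
  assume k: "1 \<le> k"
  have "{(0, 0)} \<subseteq> rect (enat 1) (enat 1)" by (auto simp: rect_def)
  from gamma_le[OF spans_block[OF this, of k k 2]] k show ?thesis
    by (simp add: ecard_rect one_enat_def del: One_nat_def)
qed

section \<open>The ratio for L = 2 from the cross\<close>

definition cross_zero_set :: "nat \<Rightarrow> (nat \<times> nat) set" where
  "cross_zero_set k = {..<k} \<times> {..<k} \<union> {..<k^2} \<times> {0} \<union> {0} \<times> {..<k^2}"

lemma zero_set_cross: "zero_set (cross_zero_set k)"
  by (auto simp: zero_set_def cross_zero_set_def)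

lemma origin_mem_cross: "1 \<le> k \<Longrightarrow> (0, 0) \<in> cross_zero_set k"
  by (simp add: cross_zero_set_def)

lemma outside_cross:
  assumes "1 \<le> k"
  shows "outside (cross_zero_set k) x y \<longleftrightarrow>
    enat (k^2) \<le> x \<or> enat (k^2) \<le> y \<or> enat k \<le> x \<and> 1 \<le> y \<or> 1 \<le> x \<and> enat k \<le> y"
proof -
  have "k \<le> k^2" using assms by (simp add: power2_eq_square)
  then show ?thesis
    by (cases x; cases y) (use assms in \<open>auto simp: cross_zero_set_def one_enat_def\<close>, auto simp: outside_def)
qed

text \<open>A smaller set has an empty row and an empty column. Their crossing needs k vertices of
  one of these lines to be occupied at time 1, and each of those needs \<open>k^2\<close> vertices
  of A in its other line.\<close>

lemma gamma_2_cross_ge: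
  assumes "1 \<le> k"
  shows "enat (k^3) \<le> gamma 2 (cross_zero_set k) (enat (k^3)) (enat (k^3))"
proof (rule le_gammaI, rule ccontr)
  let ?Z = "cross_zero_set k" and ?R = "rect (enat (k^3)) (enat (k^3))"
  fix A assume A: "spans 2 ?Z (k^3) (k^3) A" "\<not> enat (k^3) \<le> ecard A"
  have k2: "k \<le> k^2" using assms by (simp add: power2_eq_square)
  let ?T = "growth_step ?Z (k^3) (k^3)"
  have sub: "A \<subseteq> ?R" using A(1) by (simp add: spans_def)
  then have fin: "finite A" "card A < k^3" using A(2) finite_rect by (auto simp: ecard_def)
  from fin(1) fin(2) fin(2) obtain j i where ji: "j < k^3" "col A j = {}" "i < k^3" "row A i = {}"
    by (rule ex_empty_lines)
  have sub': "?T A \<subseteq> ?R" using sub by (rule growth_step_subset_rect)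
  have "(j, i) \<in> ?T (?T A)"
    using A(1) ji by (simp add: spans_def growth_def rect_def numeral_eq_enat numeral_2_eq_2)
  \<comment> \<open>The crossing of two empty lines has counts (0, 0) at time 0.\<close>
  moreover have "(j, i) \<notin> ?T A"
    using ji origin_mem_cross[OF assms] by (simp add: mem_growth_step[OF sub] zero_enat_def)
  ultimately have "outside ?Z (ecard (row (?T A) i)) (ecard (col (?T A) j))"
    by (simp add: mem_growth_step[OF sub'])
  \<comment> \<open>Every way of leaving the cross needs a count of at least k in some
    direction.\<close>
  then have "enat k \<le> ecard (row (?T A) i) \<or> enat k \<le> ecard (col (?T A) j)"
    using assms k2 order_trans[of "enat k" "enat (k^2)"] by (auto simp: outside_cross)
  then show False
  proof
    assume "enat k \<le> ecard (row (?T A) i)"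
    then obtain Y where Y: "Y \<subseteq> row (?T A) i" "finite Y" "card Y = k"
      unfolding enat_le_ecard_iff by blast
    have fin_col: "finite (col A y)" for y using fin(1) by (rule finite_col)
    have "k^2 \<le> card (col A y)" if "y \<in> Y" for y
    proof -
      have "(y, i) \<in> ?T A" using Y(1) that by auto
      then have "outside ?Z 0 (ecard (col A y))"
        using ji by (auto simp: mem_growth_step[OF sub])
      then show ?thesis
        using fin_col[of y] outside_cross[OF assms, of 0 "ecard (col A y)"] assms
        by (simp add: ecard_def zero_enat_def one_enat_def)
    qed
    then have "k * k^2 \<le> (\<Sum>y\<in>Y. card (col A y))" using sum_bounded_below[of Y "k^2"] Y(3) by auto
    also have "\<dots> = card (SIGMA y:Y. col A y)" using Y(2) fin_col by simp
    also have "\<dots> \<le> card A" by (rule card_mono) (use fin in auto)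
    finally show False using fin(2) by (simp add: power2_eq_square power3_eq_cube)
  next
    assume "enat k \<le> ecard (col (?T A) j)"
    then obtain X where X: "X \<subseteq> col (?T A) j" "finite X" "card X = k"
      unfolding enat_le_ecard_iff by blast
    have fin_row: "finite (row A x)" for x using fin(1) by (rule finite_row)
    have "k^2 \<le> card (row A x)" if "x \<in> X" for x
    proof -
      have "(j, x) \<in> ?T A" using X(1) that by auto
      then have "outside ?Z (ecard (row A x)) 0"
        using ji by (auto simp: mem_growth_step[OF sub])
      then show ?thesis
        using fin_row[of x] outside_cross[OF assms, of "ecard (row A x)" 0] assms
        by (simp add: ecard_def zero_enat_def one_enat_def)
    qed
    then have "k * k^2 \<le> (\<Sum>x\<in>X. card (row A x))" using sum_bounded_below[of X "k^2"] X(3) by auto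
    also have "\<dots> = card (SIGMA x:X. row A x)" using X(2) fin_row by simp
    also have "\<dots> \<le> card (A\<inverse>)" by (rule card_mono) (use fin in auto)
    finally show False using fin(2) by (simp add: card_inverse power2_eq_square power3_eq_cube)
  qed
qed

text \<open>The first step fills row 0 and column 0 from the arms. In the second, the k lowest rows
  fill, by k vertices in the row and the one in row 0. In the third, every column holds k vertices
  and column 0 supplies the one vertex in each row.\<close>

lemma gamma_3_cross_le:
  assumes "1 \<le> k"
  shows "gamma 3 (cross_zero_set k) (enat (k^3)) (enat (k^3)) \<le> enat (4 * k^2)"
proof -
  let ?Z = "cross_zero_set k" and ?R = "rect (enat (k^3)) (enat (k^3))"
  let ?T = "growth_step ?Z (k^3) (k^3)"
  \<comment> \<open>The seed is a copy of the cross itself: three pieces of at most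
    \<open>k^2\<close> vertices each.\<close>
  define A :: "(nat \<times> nat) set" where
    "A = {..<k^2} \<times> {0} \<union> {0} \<times> {..<k^2} \<union> {..<k} \<times> {..<k}"
  have le: "k \<le> k^2" "k^2 \<le> k^3" "1 \<le> k^2"
    using assms by (auto simp: power2_eq_square power3_eq_cube)
  have A: "A \<subseteq> ?R" using le assms by (auto simp: A_def rect_def)
  have TA: "?T A \<subseteq> ?R" using A by (rule growth_step_subset_rect)
  have TTA: "?T (?T A) \<subseteq> ?R" using TA by (rule growth_step_subset_rect)
  have row0: "(j, 0) \<in> ?T A" if "j < k^3" for j
  proof -
    have "enat (k^2) \<le> ecard (row A 0)"
      unfolding enat_le_ecard_iff by (rule exI[of _ "{..<k^2}"]) (auto simp: A_def)
    then show ?thesis using that assms by (simp add: mem_growth_step[OF A] outside_cross[OF assms] rect_def)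
  qed
  have col0: "(0, i) \<in> ?T A" if "i < k^3" for i
  proof -
    have "enat (k^2) \<le> ecard (col A 0)"
      unfolding enat_le_ecard_iff by (rule exI[of _ "{..<k^2}"]) (auto simp: A_def)
    then show ?thesis using that assms by (simp add: mem_growth_step[OF A] outside_cross[OF assms] rect_def)
  qed
  have rows: "(j, i) \<in> ?T (?T A)" if "j < k^3" "i < k" for j i
  proof -
    have "{..<k} \<subseteq> row (?T A) i" using that(2) by (auto simp: A_def intro: growth_step_increasing)
    then have "enat k \<le> ecard (row (?T A) i)"
      unfolding enat_le_ecard_iff by (metis card_lessThan finite_lessThan)
    moreover have "col (?T A) j \<noteq> {}" using row0[OF that(1)] by auto
    then have "1 \<le> ecard (col (?T A) j)" by (simp add: ileI1 one_eSuc del: Collect_empty_eq)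
    ultimately show ?thesis
      using that le by (simp add: mem_growth_step[OF TA] outside_cross[OF assms] rect_def)
  qed
  have "(j, i) \<in> ?T (?T (?T A))" if ji: "j < k^3" "i < k^3" for j i
  proof -
    have "{..<k} \<subseteq> col (?T (?T A)) j" using rows ji(1) by auto
    then have "enat k \<le> ecard (col (?T (?T A)) j)"
      unfolding enat_le_ecard_iff by (metis card_lessThan finite_lessThan)
    moreover have "row (?T (?T A)) i \<noteq> {}"
      using growth_step_increasing[OF col0[OF ji(2)]] by auto
    then have "1 \<le> ecard (row (?T (?T A)) i)" by (simp add: ileI1 one_eSuc del: Collect_empty_eq)
    ultimately show ?thesis
      using ji by (simp add: mem_growth_step[OF TTA] outside_cross[OF assms] rect_def)
  qed
  then have "?R \<subseteq> (?T ^^ 3) A" by (auto simp: rect_def numeral_3_eq_3)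
  then have "spans 3 ?Z (k^3) (k^3) A"
    by (rule spans_iterateI[OF A]) (simp add: numeral_eq_enat)
  moreover have "ecard A \<le> enat (4 * k^2)"
  proof -
    have "card A \<le> k^2 + k^2 + k^2"
      by (unfold A_def, intro order_trans[OF card_Un_le] add_mono)
        (auto simp: card_cartesian_product power2_eq_square)
    then show ?thesis by (simp add: ecard_def A_def)
  qed
  ultimately show ?thesis using gamma_le order_trans by blast
qed

theorem theorem1p6:
  "(\<forall>(Z :: (nat \<times> nat) set) (a :: nat) (b :: nat) (L :: enat) (m :: nat) (n :: nat).
      zero_set Z \<and> 1 \<le> a \<and> 1 \<le> b \<and> Z \<subseteq> rect (enat a) (enat b) \<and>
      2 \<le> L \<and> a * b < m \<and> a * b < n \<longrightarrow>
        gamma L Z (enat m) (enat n) = gamma L Z \<infinity> \<infinity> \<and>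
        (enat (2 * a * b + 5) \<le> L \<longrightarrow>
           gamma L Z (enat m) (enat n) = gamma \<infinity> Z \<infinity> \<infinity> \<and>
           ereal_of_enat (gamma \<infinity> Z \<infinity> \<infinity>)
             \<in> {ereal (real (card Z) / 4) .. ereal (real (card Z))})) \<and>
   (\<forall>L \<in> {0, 1, 2 :: enat}.
      (SUP (Z, m, n) \<in> {(Z :: (nat \<times> nat) set, m :: nat, n :: nat).
                         finite Z \<and> zero_set Z \<and> 1 \<le> m \<and> 1 \<le> n \<and>
                         0 < gamma (L + 1) Z (enat m) (enat n)}.
         ereal_of_enat (gamma L Z (enat m) (enat n)) /
         ereal_of_enat (gamma (L + 1) Z (enat m) (enat n))) = \<infinity>)"
proof (intro conjI allI impI ballI)
  fix Z :: "(nat \<times> nat) set" and a b m n :: nat and L :: enat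
  assume *: "zero_set Z \<and> 1 \<le> a \<and> 1 \<le> b \<and> Z \<subseteq> rect (enat a) (enat b) \<and>
      2 \<le> L \<and> a * b < m \<and> a * b < n"
  then show eq: "gamma L Z (enat m) (enat n) = gamma L Z \<infinity> \<infinity>"
    using gamma_eq_plane by blast
  assume "enat (2 * a * b + 5) \<le> L"
  then have "enat (2 * a * b + 3) \<le> L" by (rule order_trans[rotated]) simp
  then show "gamma L Z (enat m) (enat n) = gamma \<infinity> Z \<infinity> \<infinity>"
    using eq gamma_plane_eq_infinity * by metis
  show "ereal_of_enat (gamma \<infinity> Z \<infinity> \<infinity>)
      \<in> {ereal (real (card Z) / 4) .. ereal (real (card Z))}"
    using gamma_infinity_bounds * by blast
next
  fix L :: enat
  assume "L \<in> {0, 1, 2}"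
  then consider "L = 0" "L + 1 = 1" | "L = 1" "L + 1 = 2" | "L = 2" "L + 1 = 3"
    by (auto simp: numeral_eq_enat one_enat_def zero_enat_def)
  then show "(SUP (Z, m, n) \<in> {(Z :: (nat \<times> nat) set, m :: nat, n :: nat).
                         finite Z \<and> zero_set Z \<and> 1 \<le> m \<and> 1 \<le> n \<and>
                         0 < gamma (L + 1) Z (enat m) (enat n)}.
         ereal_of_enat (gamma L Z (enat m) (enat n)) /
         ereal_of_enat (gamma (L + 1) Z (enat m) (enat n))) = \<infinity>"
  proof cases
    case 1
    show ?thesis unfolding 1(2) unfolding 1(1)
    \<comment> \<open>On a k-by-k board the sizes are \<open>k * k\<close> against at most
      k.\<close>
    proof (rule growth_ratio_unbounded[where Z = "\<lambda>_. {(0, 0)}" and N = id and c = id])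
      fix k :: nat assume "1 \<le> k"
      show "gamma 1 {(0, 0)} (enat (id k)) (enat (id k)) \<le> enat (4 * id k)"
        using order_trans[OF gamma_1_origin_le[OF \<open>1 \<le> k\<close>]] by simp
    qed (auto simp: gamma_0 zero_set_origin)
  next
    case 2
    show ?thesis unfolding 2(2) unfolding 2(1)
    \<comment> \<open>Here the sizes are at least k against at most 1.\<close>
    proof (rule growth_ratio_unbounded[where Z = "\<lambda>_. {(0, 0)}" and N = id and c = "\<lambda>_. 1"])
      fix k :: nat assume "1 \<le> k"
      show "gamma 2 {(0, 0)} (enat (id k)) (enat (id k)) \<le> enat (4 * 1)"
        using order_trans[OF gamma_2_origin_le[OF \<open>1 \<le> k\<close>]] by (simp add: one_enat_def)
    qed (auto simp: gamma_1_origin_ge zero_set_origin)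
  next
    case 3
    show ?thesis unfolding 3(2) unfolding 3(1)
    \<comment> \<open>The board of side \<open>k^3\<close> is just large enough for a set of fewer
      than \<open>k^3\<close> vertices to miss a row and a column; the sizes are at least
      \<open>k^3\<close> against at most \<open>4 * k^2\<close>.\<close>
    proof (rule growth_ratio_unbounded[where Z = cross_zero_set and N = "\<lambda>k. k^3" and c = "\<lambda>k. k^2"])
      fix k :: nat assume k: "1 \<le> k"
      show "enat (k * k^2) \<le> gamma 2 (cross_zero_set k) (enat (k^3)) (enat (k^3))"
        using gamma_2_cross_ge[OF k] by (simp add: power2_eq_square power3_eq_cube mult.assoc)
      show "finite (cross_zero_set k) \<and> zero_set (cross_zero_set k) \<and> (0, 0) \<in> cross_zero_set k \<and> 1 \<le> k^3"
        using k zero_set_cross origin_mem_cross by (simp add: cross_zero_set_def)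
    qed (rule gamma_3_cross_le)
  qed
qed

end
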